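(* Let $(P,\preceq)$ be a lattice, let $S=\{x_1,\ldots,x_n\}$ be a finite subset of $P$ with distinct elements such that $x_i\preceq x_j\Rightarrow i\leq j$, and let $f_1,\ldots,f_n:P\to\mathbb{C}$. Suppose that $S$ is meet closed. Then the row-adjusted meet matrix $(S)_{f_1,\ldots,f_n}=(f_i(x_i\wedge x_j))_{i,j=1}^n$ is invertible if and only if $\Psi_{S,f_i}(x_i)\neq 0$ for all $i=1,\ldots,n$. Furthermore, in this case the inverse of $(S)_{f_1,\ldots,f_n}$ is the $n\times n$ matrix $B=(b_{ij})$ with $$b_{ij}=\sum_{k=j}^n\mu_S(x_i,x_k)\theta_{kj},$$ where for each $j$ the numbers $\theta_{jj},\theta_{j+1,j},\ldots,\theta_{nj}$ are defined recursively by $$\theta_{jj}=\frac{1}{\Psi_{S,f_j}(x_j)},\qquad \theta_{kj}=-\frac{1}{\Psi_{S,f_k}(x_k)}\sum_{u=j}^{k-1}e_{ku}\Psi_{S,f_k}(x_u)\theta_{uj}\quad\text{if }k>j.$$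
   Context: $S$ is meet closed if $x\wedge y\in S$ for all $x,y\in S$. For each $i=1,\ldots,n$ the function $\Psi_{S,f_i}:S\to\mathbb{C}$ is defined inductively by $$\Psi_{S,f_i}(x_k)=f_i(x_k)-\sum_{x_v\prec x_k}\Psi_{S,f_i}(x_v),$$ the sum being over $x_v\in S$; equivalently, $f_i(x_k)=\sum_{x_v\preceq x_k}\Psi_{S,f_i}(x_v)$ for all $k$. The numbers $e_{ku}$ are given by $e_{ku}=1$ if $x_u\preceq x_k$ and $e_{ku}=0$ otherwise. $\mu_S$ is the Möbius function of the finite poset $(S,\preceq)$, with the convention $\mu_S(x,y)=0$ if $x\not\preceq y$. *)

theory Defs
  imports Complex_Main "Jordan_Normal_Form.Matrix"
begin

text \<open>
  The ambient lattice \<open>P\<close> is a type of class \<^class>\<open>lattice\<close>, with meet \<^const>\<open>inf\<close>.  The elements of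
  \<open>S\<close> are numbered \<open>x 0, \<dots>, x (n - 1)\<close>, so all indices are shifted by one with respect to the
  numbering \<open>1, \<dots>, n\<close>; this is the convention of the matrix library.
\<close>

definition meet_closed :: "'a::semilattice_inf set \<Rightarrow> bool" where
  "meet_closed S \<longleftrightarrow> (\<forall>y\<in>S. \<forall>z\<in>S. inf y z \<in> S)"

lemma card_below_less:
  fixes S :: "'a::order set"
  assumes "finite S" "z \<in> S" "z < y"
  shows "card {w \<in> S. w < z} < card {w \<in> S. w < y}"
  using assms by (intro psubset_card_mono) auto

text \<open>
  The guards \<open>finite S\<close> in the next two definitions only serve to make the recursions terminate for
  every \<open>S\<close>; \<open>Psi_rec\<close> and \<open>moebius_rec\<close> are the equations without the guard.
\<close>

function Psi :: "'a::order set \<Rightarrow> ('a \<Rightarrow> complex) \<Rightarrow> 'a \<Rightarrow> complex" where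
  "Psi S g y = g y - (\<Sum>z\<in>{z. finite S \<and> z \<in> S \<and> z < y}. Psi S g z)"
  by pat_completeness auto
termination
  by (relation "Wellfounded.measure (\<lambda>(S, g, y). card {w \<in> S. w < y})")
     (auto intro: card_below_less)

text \<open>The Moebius function of the poset \<open>S\<close>; it is meaningful for arguments in \<open>S\<close> only.\<close>

function moebius :: "'a::order set \<Rightarrow> 'a \<Rightarrow> 'a \<Rightarrow> int" where
  "moebius S a b =
     (if a = b then 1
      else if a < b then - (\<Sum>z\<in>{z. finite S \<and> z \<in> S \<and> a \<le> z \<and> z < b}. moebius S a z)
      else 0)"
  by pat_completeness auto
termination
  by (relation "Wellfounded.measure (\<lambda>(S, a, b). card {w \<in> S. w < b})")
     (auto intro: card_below_less)

declare Psi.simps [simp del] moebius.simps [simp del]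

lemma Psi_rec:
  "finite S \<Longrightarrow> Psi S g y = g y - (\<Sum>z\<in>{z \<in> S. z < y}. Psi S g z)"
  by (subst Psi.simps) simp

lemma Psi_sum:
  assumes "finite S" "y \<in> S"
  shows "(\<Sum>z\<in>{z \<in> S. z \<le> y}. Psi S g z) = g y"
proof -
  have "{z \<in> S. z \<le> y} = insert y {z \<in> S. z < y}"
    using assms(2) by auto
  then show ?thesis
    using assms(1) by (simp add: Psi_rec[of S g y])
qed

lemma moebius_refl [simp]: "moebius S a a = 1"
  by (subst moebius.simps) simp

lemma moebius_eq_0: "\<not> a \<le> b \<Longrightarrow> moebius S a b = 0"
  by (subst moebius.simps) auto

lemma moebius_rec:
  "finite S \<Longrightarrow> a < b \<Longrightarrow>
     moebius S a b = - (\<Sum>z\<in>{z \<in> S. a \<le> z \<and> z < b}. moebius S a z)"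
  by (subst moebius.simps) auto

lemma moebius_sum:
  assumes "finite S" "b \<in> S"
  shows "(\<Sum>z\<in>{z \<in> S. a \<le> z \<and> z \<le> b}. moebius S a z) = (if a = b then 1 else 0)"
proof (cases "a < b")
  case True
  then have "{z \<in> S. a \<le> z \<and> z \<le> b} = insert b {z \<in> S. a \<le> z \<and> z < b}"
    using assms(2) by auto
  then show ?thesis
    using assms(1) True by (simp add: moebius_rec[of S a b])
next
  case False
  then have "{z \<in> S. a \<le> z \<and> z \<le> b} = (if a = b then {b} else {})"
    using assms(2) by (auto simp: order.order_iff_strict)
  then show ?thesis
    by simp
qed

definition inc :: "(nat \<Rightarrow> 'a::order) \<Rightarrow> nat \<Rightarrow> nat \<Rightarrow> complex" where
  "inc x k u = (if x u \<le> x k then 1 else 0)"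

text \<open>
  \<open>theta S x f k j\<close> is \<open>\<theta>\<^sub>k\<^sub>j\<close>, which is defined for \<open>k \<ge> j\<close> only; the value \<open>0\<close> for \<open>k < j\<close> is a
  dummy.
\<close>

fun theta ::
  "'a::order set \<Rightarrow> (nat \<Rightarrow> 'a) \<Rightarrow> (nat \<Rightarrow> 'a \<Rightarrow> complex) \<Rightarrow> nat \<Rightarrow> nat \<Rightarrow> complex" where
  "theta S x f k j =
     (if k = j then 1 / Psi S (f j) (x j)
      else if k > j then
        - (1 / Psi S (f k) (x k)) * (\<Sum>u\<in>{j..<k}. inc x k u * Psi S (f k) (x u) * theta S x f u j)
      else 0)"

declare theta.simps [simp del]

definition row_adjusted_meet_matrix ::
  "nat \<Rightarrow> (nat \<Rightarrow> 'a::semilattice_inf) \<Rightarrow> (nat \<Rightarrow> 'a \<Rightarrow> complex) \<Rightarrow> complex mat" where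
  "row_adjusted_meet_matrix n x f = mat n n (\<lambda>(i, j). f i (inf (x i) (x j)))"

end

theory Submission
  imports Defs "Jordan_Normal_Form.Determinant"
begin

text \<open>
  Writing \<open>f\<^sub>i(x\<^sub>i \<and> x\<^sub>j)\<close> as a sum of \<open>\<Psi>\<^bsub>S,f\<^sub>i\<^esub>\<close> over the elements of \<open>S\<close> below both \<open>x\<^sub>i\<close> and \<open>x\<^sub>j\<close>
  factors the matrix as \<open>L Z\<close>, where \<open>L = (e\<^sub>i\<^sub>k \<Psi>\<^bsub>S,f\<^sub>i\<^esub>(x\<^sub>k))\<close> is lower triangular and \<open>Z\<close> is the zeta
  matrix of \<open>S\<close>. The Moebius matrix inverts \<open>Z\<close>, and the recursion for \<open>\<theta>\<close> is forward
  substitution for the inverse of \<open>L\<close>.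
\<close>

text \<open>The arguments of \<open>inc\<close> are swapped so that rows belong to the lower
  element: entry \<open>(k, j)\<close> is 1 exactly if \<open>x k \<le> x j\<close>.\<close>

definition zeta_mat :: "nat \<Rightarrow> (nat \<Rightarrow> 'a::order) \<Rightarrow> complex mat" where
  "zeta_mat n x = mat n n (\<lambda>(k, j). inc x j k)"

definition moebius_mat :: "nat \<Rightarrow> 'a::order set \<Rightarrow> (nat \<Rightarrow> 'a) \<Rightarrow> complex mat" where
  "moebius_mat n S x = mat n n (\<lambda>(i, k). of_int (moebius S (x i) (x k)))"

definition Psi_mat ::
  "nat \<Rightarrow> 'a::order set \<Rightarrow> (nat \<Rightarrow> 'a) \<Rightarrow> (nat \<Rightarrow> 'a \<Rightarrow> complex) \<Rightarrow> complex mat" where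
  "Psi_mat n S x f = mat n n (\<lambda>(i, k). inc x i k * Psi S (f i) (x k))"

definition theta_mat ::
  "nat \<Rightarrow> 'a::order set \<Rightarrow> (nat \<Rightarrow> 'a) \<Rightarrow> (nat \<Rightarrow> 'a \<Rightarrow> complex) \<Rightarrow> complex mat" where
  "theta_mat n S x f = mat n n (\<lambda>(k, j). theta S x f k j)"

lemma carrier_mats [simp]:
  "zeta_mat n x \<in> carrier_mat n n"
  "moebius_mat n S x \<in> carrier_mat n n"
  "Psi_mat n S x f \<in> carrier_mat n n"
  "theta_mat n S x f \<in> carrier_mat n n"
  by (simp_all add: zeta_mat_def moebius_mat_def Psi_mat_def theta_mat_def)

lemma mat_mult_mat:
  "mat n m f * mat m p g = mat n p (\<lambda>(i, j). \<Sum>k<m. f (i, k) * g (k, j))"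
  by (rule eq_matI) (auto simp: scalar_prod_def lessThan_atLeast0)

text \<open>Bridge from sums over subsets of \<open>S\<close>, as in the recursions for
  \<open>Psi\<close> and \<open>moebius\<close>, to the sums over indices in matrix products;
  injectivity keeps elements from being counted twice.\<close>

lemma sum_enum:
  fixes n :: nat
  assumes "S = x ` {..<n}" "inj_on x {..<n}"
  shows "(\<Sum>z\<in>{z \<in> S. Q z}. h z) = (\<Sum>k<n. if Q (x k) then h (x k) else 0)"
proof -
  have "(\<Sum>z\<in>{z \<in> S. Q z}. h z) = (\<Sum>z\<in>S. if Q z then h z else 0)"
    using assms(1) by (intro sum.inter_filter) simp
  also have "\<dots> = (\<Sum>k<n. if Q (x k) then h (x k) else 0)"
    using assms by (simp add: sum.reindex)
  finally show ?thesis .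
qed

lemma theta_eq_0: "k < j \<Longrightarrow> theta S x f k j = 0"
  by (subst theta.simps) simp

lemma row_adjusted_meet_matrix_factorization:
  fixes x :: "nat \<Rightarrow> 'a::semilattice_inf"
  assumes S: "S = x ` {..<n}" "inj_on x {..<n}" and "meet_closed S"
  shows "row_adjusted_meet_matrix n x f = Psi_mat n S x f * zeta_mat n x"
proof -
  have "f i (inf (x i) (x j)) = (\<Sum>k<n. inc x i k * Psi S (f i) (x k) * inc x j k)"
    if "i < n" "j < n" for i j
  proof -
    \<comment> \<open>Meet closure enters here: \<open>Psi_sum\<close> recovers the value of
      \<open>f i\<close> only at points of \<open>S\<close>.\<close>
    have "inf (x i) (x j) \<in> S"
      using that assms by (auto simp: meet_closed_def)
    then have "f i (inf (x i) (x j)) = (\<Sum>z\<in>{z \<in> S. z \<le> inf (x i) (x j)}. Psi S (f i) z)"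
      using S(1) by (subst Psi_sum) auto
    also have "\<dots> = (\<Sum>k<n. inc x i k * Psi S (f i) (x k) * inc x j k)"
      \<comment> \<open>Lying below the meet means lying below both elements, so the condition
        splits into two incidence factors.\<close>
      unfolding sum_enum[OF S] by (intro sum.cong) (auto simp: inc_def)
    finally show ?thesis .
  qed
  then show ?thesis
    unfolding Psi_mat_def zeta_mat_def row_adjusted_meet_matrix_def mat_mult_mat
    by (intro cong_mat) auto
qed

lemma moebius_mat_mult_zeta_mat:
  assumes S: "S = x ` {..<n}" "inj_on x {..<n}"
  shows "moebius_mat n S x * zeta_mat n x = 1\<^sub>m n"
proof -
  have "(\<Sum>k<n. of_int (moebius S (x i) (x k)) * inc x j k) = (if i = j then 1 else 0)"
    if "i < n" "j < n" for i j
  proof -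
    have "(\<Sum>k<n. of_int (moebius S (x i) (x k)) * inc x j k)
        = of_int (\<Sum>k<n. if x i \<le> x k \<and> x k \<le> x j then moebius S (x i) (x k) else 0)"
      \<comment> \<open>Terms with \<open>x k\<close> not above \<open>x i\<close> vanish by
        \<open>moebius_eq_0\<close>, which leaves the sum over the interval from \<open>x i\<close>
        to \<open>x j\<close>.\<close>
      unfolding of_int_sum by (intro sum.cong) (auto simp: inc_def moebius_eq_0)
    also have "\<dots> = of_int (\<Sum>z\<in>{z \<in> S. x i \<le> z \<and> z \<le> x j}. moebius S (x i) z)"
      unfolding sum_enum[OF S] ..
    also have "\<dots> = (if i = j then 1 else 0)"
      using that S by (subst moebius_sum) (auto dest: inj_onD)
    finally show ?thesis .
  qed
  then show ?thesis
    unfolding moebius_mat_def zeta_mat_def one_mat_def mat_mult_mat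
    by (intro cong_mat) auto
qed

lemma Psi_mat_mult_theta_mat:
  assumes order: "\<And>i j. i < n \<Longrightarrow> j < n \<Longrightarrow> x i \<le> x j \<Longrightarrow> i \<le> j"
    and nz: "\<And>i. i < n \<Longrightarrow> Psi S (f i) (x i) \<noteq> 0"
  shows "Psi_mat n S x f * theta_mat n S x f = 1\<^sub>m n"
proof -
  have "(\<Sum>k<n. inc x i k * Psi S (f i) (x k) * theta S x f k j) = (if i = j then 1 else 0)"
    (is "(\<Sum>k<n. ?t k) = _") if ij: "i < n" "j < n" for i j
  proof -
    \<comment> \<open>For \<open>k < j\<close> the dummy value of \<open>theta\<close> is 0; for
      \<open>k > i\<close> the numbering excludes \<open>x k \<le> x i\<close>, so the incidence
      factor is 0.\<close>
    have "(\<Sum>k<n. ?t k) = (\<Sum>k\<in>{j..<Suc i}. ?t k)"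
    proof (intro sum.mono_neutral_right ballI)
      fix k assume k: "k \<in> {..<n} - {j..<Suc i}"
      then consider "k < j" | "i < k"
        by fastforce
      then show "?t k = 0"
      proof cases
        case 2
        then have "\<not> x k \<le> x i"
          using order[of k i] k ij by auto
        then show ?thesis
          by (simp add: inc_def)
      qed (simp add: theta_eq_0)
    qed (use ij in auto)
    also have "\<dots> = (if i = j then 1 else 0)"
    proof (cases i j rule: linorder_cases)
      case less
      then show ?thesis by simp
    next
      case equal
      then show ?thesis
        using nz[OF ij(1)] by (simp add: inc_def theta.simps[of S x f j j])
    next
      case greater
      then have "(\<Sum>k\<in>{j..<Suc i}. ?t k)
          = (\<Sum>k\<in>{j..<i}. ?t k) + Psi S (f i) (x i) * theta S x f i j"
        by (simp add: inc_def)
      \<comment> \<open>The recursion defines \<open>theta S x f i j\<close> so that, multiplied by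
        the nonzero pivot \<open>Psi S (f i) (x i)\<close>, it cancels the earlier terms.\<close>
      also have "\<dots> = 0"
        using greater nz[OF ij(1)] by (simp add: theta.simps[of S x f i j])
      finally show ?thesis
        using greater by simp
    qed
    finally show ?thesis .
  qed
  then show ?thesis
    unfolding Psi_mat_def theta_mat_def one_mat_def mat_mult_mat
    by (intro cong_mat) auto
qed

text \<open>The numbering makes the matrix lower triangular, and reflexivity turns the incidence
  factors on the diagonal into 1.\<close>

lemma det_Psi_mat:
  assumes "\<And>i j. i < n \<Longrightarrow> j < n \<Longrightarrow> x i \<le> x j \<Longrightarrow> i \<le> j"
  shows "det (Psi_mat n S x f) = (\<Prod>i<n. Psi S (f i) (x i))"
proof -
  have "det (Psi_mat n S x f) = prod_list (diag_mat (Psi_mat n S x f))"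
  proof (rule det_lower_triangular[of n])
    fix i j :: nat assume "i < j" "j < n"
    then show "Psi_mat n S x f $$ (i, j) = 0"
      using assms[of j i] by (auto simp: Psi_mat_def inc_def)
  qed simp
  also have "\<dots> = (\<Prod>i<n. Psi S (f i) (x i))"
    by (simp add: prod_list_diag_prod Psi_mat_def inc_def lessThan_atLeast0)
  finally show ?thesis .
qed

text \<open>The dummy zeros of \<open>theta\<close> for \<open>k < j\<close> let the full matrix
  product start at \<open>k = j\<close>.\<close>

lemma moebius_mat_mult_theta_mat:
  "moebius_mat n S x * theta_mat n S x f
    = mat n n (\<lambda>(i, j). \<Sum>k\<in>{j..<n}. of_int (moebius S (x i) (x k)) * theta S x f k j)"
proof -
  have "(\<Sum>k<n. of_int (moebius S (x i) (x k)) * theta S x f k j)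
      = (\<Sum>k\<in>{j..<n}. of_int (moebius S (x i) (x k)) * theta S x f k j)" for i j
    by (intro sum.mono_neutral_right) (auto simp: theta_eq_0)
  then show ?thesis
    unfolding moebius_mat_def theta_mat_def mat_mult_mat by (intro cong_mat) auto
qed

lemma invertible_mat_imp_det_nonzero:
  fixes A :: "'a::field mat"
  assumes A: "A \<in> carrier_mat n n" and "invertible_mat A"
  shows "det A \<noteq> 0"
proof -
  obtain B where AB: "A * B = 1\<^sub>m n" and BA: "B * A = 1\<^sub>m (dim_row B)"
    using assms by (auto simp: invertible_mat_def inverts_mat_def)
  \<comment> \<open>\<open>invertible_mat\<close> leaves the size of \<open>B\<close> open; counting
    columns in the two products determines it.\<close>
  have B: "B \<in> carrier_mat n n"
    using arg_cong[OF AB, of dim_col] arg_cong[OF BA, of dim_col] A by auto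
  show ?thesis
    using det_mult[OF A B] AB by auto
qed

theorem theorem6p1:
  fixes n :: nat
    and x :: "nat \<Rightarrow> 'a::lattice"
    and S :: "'a set"
    and f :: "nat \<Rightarrow> 'a \<Rightarrow> complex"
  assumes "S = x ` {..<n}"
    and "inj_on x {..<n}"
    and "\<And>i j. i < n \<Longrightarrow> j < n \<Longrightarrow> x i \<le> x j \<Longrightarrow> i \<le> j"
    and "meet_closed S"
  defines "A \<equiv> row_adjusted_meet_matrix n x f"
    and "B \<equiv> mat n n (\<lambda>(i, j). \<Sum>k\<in>{j..<n}. of_int (moebius S (x i) (x k)) * theta S x f k j)"
  shows "(invertible_mat A \<longleftrightarrow> (\<forall>i<n. Psi S (f i) (x i) \<noteq> 0))
    \<and> (invertible_mat A \<longrightarrow> inverts_mat A B \<and> inverts_mat B A)"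
proof -
  let ?L = "Psi_mat n S x f" and ?Z = "zeta_mat n x"
  let ?M = "moebius_mat n S x" and ?T = "theta_mat n S x f"
  have A_eq: "A = ?L * ?Z"
    unfolding A_def by (rule row_adjusted_meet_matrix_factorization) fact+
  have B_eq: "B = ?M * ?T"
    unfolding B_def by (rule moebius_mat_mult_theta_mat[symmetric])
  have A: "A \<in> carrier_mat n n" and B: "B \<in> carrier_mat n n"
    by (simp_all add: A_def B_def row_adjusted_meet_matrix_def)
  have nonzero: "\<forall>i<n. Psi S (f i) (x i) \<noteq> 0" if "invertible_mat A"
  proof -
    \<comment> \<open>This product is \<open>det A\<close>; its factor \<open>det ?L\<close> is
      therefore nonzero, and with it each diagonal value of \<open>Psi\<close>.\<close>
    have "det ?L * det ?Z \<noteq> 0"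
      using invertible_mat_imp_det_nonzero[OF A that] A_eq det_mult[of ?L n ?Z] by simp
    then show ?thesis
      using det_Psi_mat[OF assms(3), where S = S and f = f] by auto
  qed
  have inverse: "inverts_mat A B \<and> inverts_mat B A" if nz: "\<forall>i<n. Psi S (f i) (x i) \<noteq> 0"
  proof -
    \<comment> \<open>In \<open>A * B = ?L * ?Z * ?M * ?T\<close> the inner pair occurs in this
      order; for square matrices a one-sided inverse is two-sided.\<close>
    have ZM: "?Z * ?M = 1\<^sub>m n"
      by (rule mat_mult_left_right_inverse[OF _ _ moebius_mat_mult_zeta_mat[OF assms(1,2)]])
        simp_all
    have LT: "?L * ?T = 1\<^sub>m n"
      by (rule Psi_mat_mult_theta_mat[OF assms(3)]) (use nz in auto)
    have "A * B = ?L * (?Z * (?M * ?T))"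
      unfolding A_eq B_eq by (rule assoc_mult_mat[of _ n n _ n _ n]) (auto intro: mult_carrier_mat[of _ n n])
    also have "?Z * (?M * ?T) = (?Z * ?M) * ?T"
      by (rule assoc_mult_mat[of _ n n _ n _ n, symmetric]) auto
    also have "?L * \<dots> = 1\<^sub>m n"
      by (simp add: ZM LT left_mult_one_mat[of _ n n])
    finally have AB: "A * B = 1\<^sub>m n" .
    show ?thesis
      using AB mat_mult_left_right_inverse[OF A B AB] A B by (simp add: inverts_mat_def)
  qed
  have "invertible_mat A" if "\<forall>i<n. Psi S (f i) (x i) \<noteq> 0"
    using inverse[OF that] A by (auto simp: invertible_mat_def)
  with nonzero inverse show ?thesis
    by blast
qed

end
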